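(* Let $M\in\mathbb{R}^{n\times n}$ be invertible. Then $M$ has the strong inner product property if and only if $Y=O$ is the only matrix $Y\in\mathbb{R}^{n\times n}$ such that $YM^{-1}$ is symmetric and $Y\circ M=O$.
   Context: All matrices are real; $\circ$ denotes the Hadamard (entrywise) product and $O$ the zero matrix. A matrix $M\in\mathbb{R}^{m\times n}$ with $m\le n$ has the strong inner product property (SIPP) if $M$ has full rank (rank $m$) and $X=O$ is the only symmetric $m\times m$ matrix $X$ satisfying $(XM)\circ M=O$. *)

theory Defs
  imports "HOL-Analysis.Analysis"
begin

definition hadamard :: "real^'n^'m \<Rightarrow> real^'n^'m \<Rightarrow> real^'n^'m"  (infixl "\<circ>\<^sub>H" 70)
  where "A \<circ>\<^sub>H B = (\<chi> i j. A $ i $ j * B $ i $ j)"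

definition symmetric_mat :: "real^'n^'n \<Rightarrow> bool"
  where "symmetric_mat A \<longleftrightarrow> transpose A = A"

(* The type real^'n^'m consists of the matrices with CARD('m) rows and CARD('n) columns. *)
definition SIPP :: "real^'n^'m \<Rightarrow> bool"
  where "SIPP M \<longleftrightarrow>
    CARD('m) \<le> CARD('n) \<and>
    rank M = CARD('m) \<and>
    (\<forall>X::real^'m^'m. symmetric_mat X \<and> (X ** M) \<circ>\<^sub>H M = 0 \<longleftrightarrow> X = 0)"

end

theory Submission
  imports Defs
begin

text \<open>The map \<open>X \<mapsto> X M\<close> is a bijection on square matrices with inverse \<open>Y \<mapsto> Y M\<^sup>-\<^sup>1\<close>, and it
  carries the condition defining the strong inner product property to the condition on \<open>Y\<close>.\<close>

theorem theorem3p2: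
  fixes M :: "real^'n^'n"
  assumes "invertible M"
  shows "SIPP M \<longleftrightarrow>
    (\<forall>Y::real^'n^'n. symmetric_mat (Y ** matrix_inv M) \<and> Y \<circ>\<^sub>H M = 0 \<longleftrightarrow> Y = 0)"
proof -
  \<comment> \<open>\<open>matrix_inv\<close> is a Hilbert choice, so both identities come from
    \<open>someI_ex\<close>, with invertibility supplying the witness.\<close>
  have right_inv: "M ** matrix_inv M = mat 1" and left_inv: "matrix_inv M ** M = mat 1"
    using assms someI_ex[of "\<lambda>A'. M ** A' = mat 1 \<and> A' ** M = mat 1"]
    by (auto simp: invertible_def matrix_inv_def)
  have mult_inv: "(X ** M) ** matrix_inv M = X" for X :: "real^'n^'n"
    by (metis right_inv matrix_mul_assoc matrix_mul_rid)
  have inv_mult: "(Y ** matrix_inv M) ** M = Y" for Y :: "real^'n^'n"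
    by (metis left_inv matrix_mul_assoc matrix_mul_rid)
  have mult_eq_0: "X ** M = 0 \<longleftrightarrow> X = 0" for X :: "real^'n^'n"
    by (metis mult_inv times0_left)
  \<comment> \<open>A left inverse makes \<open>M\<close> injective, hence of full column rank; for
    square \<open>M\<close> only the condition on \<open>X\<close> in \<open>SIPP\<close> then
    remains.\<close>
  have "rank M = CARD('n)"
    using assms by (metis full_rank_injective invertible_left_inverse matrix_left_invertible_injective)
  then have "SIPP M \<longleftrightarrow>
      (\<forall>X::real^'n^'n. symmetric_mat X \<and> (X ** M) \<circ>\<^sub>H M = 0 \<longleftrightarrow> X = 0)"
    by (simp add: SIPP_def)
  \<comment> \<open>Substitute \<open>Y = X ** M\<close> in one direction and
    \<open>X = Y ** matrix_inv M\<close> in the other; \<open>mult_eq_0\<close> matches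
    \<open>X = 0\<close> with \<open>Y = 0\<close>.\<close>
  also have "\<dots> \<longleftrightarrow>
      (\<forall>Y::real^'n^'n. symmetric_mat (Y ** matrix_inv M) \<and> Y \<circ>\<^sub>H M = 0 \<longleftrightarrow> Y = 0)"
    by (metis mult_inv inv_mult mult_eq_0)
  finally show ?thesis .
qed

end
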